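(* Let $X$ be a Banach space of infratype $p>1$ with constant $I_p(X)$. Then, for every $k\in\mathbb N$, $$\operatorname{Car}_X(k)\le\frac{I_p(X)}{2\left(1-2^{-1+\frac1p}\right)}\,k^{-1+\frac1p}.$$
   Context: A Banach space $X$ has infratype $p\in[1,2]$ if there is a constant $I<\infty$ such that for every finite sequence $x_1,\dots,x_m\in X$, $\min_{\theta_i=\pm1}\|\sum_{i=1}^m\theta_i x_i\|\le I\left(\sum_{i=1}^m\|x_i\|^p\right)^{1/p}$; $I_p(X)$ is the least such constant. For $P\subset X$, $\operatorname{conv}_k P=\{\sum_{i=1}^s\lambda_i x_i: 1\le s\le k,\ x_i\in P,\ \lambda_i\ge0,\ \sum\lambda_i=1\}$, and $\operatorname{Car}_X(k)=\sup_P\sup_{a\in\operatorname{conv}P}\frac{\operatorname{dist}(a,\operatorname{conv}_kP)}{\operatorname{diam}P}$, the supremum over bounded sets $P\subset X$ of positive diameter. *)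

theory Defs
  imports "HOL-Analysis.Analysis"
begin

text \<open>The constraint \<open>0 \<le> I\<close> is redundant unless the space is trivial,
  in which case every real number would satisfy the inequality and no least one would exist.\<close>

definition infratype_bound :: "'a::real_normed_vector itself \<Rightarrow> real \<Rightarrow> real \<Rightarrow> bool" where
  "infratype_bound _ p I \<longleftrightarrow> 0 \<le> I \<and>
     (\<forall>(m::nat) (x :: nat \<Rightarrow> 'a).
        (MIN \<theta>\<in>{1..m} \<rightarrow>\<^sub>E {-1, 1::real}. norm (\<Sum>i=1..m. \<theta> i *\<^sub>R x i))
          \<le> I * (\<Sum>i=1..m. norm (x i) powr p) powr (1 / p))"

definition has_infratype :: "'a::real_normed_vector itself \<Rightarrow> real \<Rightarrow> bool" where
  "has_infratype X p \<longleftrightarrow> 1 \<le> p \<and> p \<le> 2 \<and> (\<exists>I. infratype_bound X p I)"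

definition infratype_const :: "'a::real_normed_vector itself \<Rightarrow> real \<Rightarrow> real" where
  "infratype_const X p = (LEAST I. infratype_bound X p I)"

lemma infratype_const:
  assumes "has_infratype (X :: 'a::real_normed_vector itself) p"
  shows "infratype_bound X p (infratype_const X p)"
    and "infratype_bound X p J \<Longrightarrow> infratype_const X p \<le> J"
proof -
  define S where "S = {I. infratype_bound X p I}"
  have ne: "S \<noteq> {}"
    using assms by (auto simp: S_def has_infratype_def)
  have bdd: "bdd_below S"
    by (rule bdd_belowI[of _ 0]) (auto simp: S_def infratype_bound_def)
  have "S = {0..} \<inter> (\<Inter>(m::nat). \<Inter>x :: nat \<Rightarrow> 'a. {I.
        (MIN \<theta>\<in>{1..m} \<rightarrow>\<^sub>E {-1, 1::real}. norm (\<Sum>i=1..m. \<theta> i *\<^sub>R x i))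
          \<le> I * (\<Sum>i=1..m. norm (x i) powr p) powr (1 / p)})"
    by (auto simp: S_def infratype_bound_def)
  also have "closed \<dots>"
    by (intro closed_Int closed_INT ballI closed_Collect_le continuous_intros closed_atLeast)
  finally have "Inf S \<in> S"
    using closed_contains_Inf ne bdd by blast
  then have *: "infratype_bound X p (Inf S)"
    by (simp add: S_def)
  have least: "Inf S \<le> J" if "infratype_bound X p J" for J
    using that bdd by (auto intro: cInf_lower simp: S_def)
  have "infratype_const X p = Inf S"
    unfolding infratype_const_def by (rule Least_equality) (use * least in auto)
  then show "infratype_bound X p (infratype_const X p)"
    and "infratype_bound X p J \<Longrightarrow> infratype_const X p \<le> J"
    using * least by auto
qed

definition conv_k :: "nat \<Rightarrow> 'a::real_vector set \<Rightarrow> 'a set" where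
  "conv_k k P = {(\<Sum>i=1..s. l i *\<^sub>R x i) | (s::nat) l x.
     1 \<le> s \<and> s \<le> k \<and> (\<forall>i\<in>{1..s}. x i \<in> P \<and> 0 \<le> l i) \<and> (\<Sum>i=1..s. l i) = 1}"

text \<open>The supremum is taken in \<^typ>\<open>ennreal\<close>, so that it is \<open>0\<close> for the trivial space,
  which has no subset of positive diameter.\<close>

definition Car :: "'a::real_normed_vector itself \<Rightarrow> nat \<Rightarrow> ennreal" where
  "Car _ k = (SUP P\<in>{P :: 'a set. bounded P \<and> 0 < diameter P}. SUP a\<in>convex hull P.
     ennreal (infdist a (conv_k k P) / diameter P))"

end

theory Submission imports Defs begin

text \<open>Approximate \<open>a\<close> by an average of \<open>2 ^ r * k\<close> points of \<open>P\<close>: the points \<open>a\<close> for which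
  \<open>N *\<^sub>R a\<close> stays within bounded distance of the sums of \<open>N\<close> points of \<open>P\<close> form a convex set
  containing \<open>P\<close>. Then halve the number of points \<open>r\<close> times. To halve \<open>2 * n\<close> points, pair them up
  and keep one point of every pair; twice the sum of the kept points differs from the whole sum by a
  signed sum of the differences of the pairs, so infratype provides a choice for which the
  average moves by at most \<open>(I * diameter P / 2) * n powr (- 1 + 1 / p)\<close>. The errors add up to a
  geometric series.\<close>

text \<open>The minimum in \<open>infratype_bound\<close> is over a finite nonempty set, hence
  attained; this turns it into an explicit choice of signs.\<close>

lemma infratype_bound_signs:
  fixes x :: "nat \<Rightarrow> 'a::real_normed_vector"
  assumes "infratype_bound TYPE('a) p I"
  obtains \<theta> :: "nat \<Rightarrow> real"
  where "\<And>i. i \<in> {1..m} \<Longrightarrow> \<theta> i \<in> {-1, 1}"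
    and "norm (\<Sum>i=1..m. \<theta> i *\<^sub>R x i) \<le> I * (\<Sum>i=1..m. norm (x i) powr p) powr (1 / p)"
proof -
  let ?T = "{1..m} \<rightarrow>\<^sub>E {-1, 1::real}"
  let ?f = "\<lambda>\<theta>. norm (\<Sum>i=1..m. \<theta> i *\<^sub>R x i)"
  have "finite ?T"
    by (intro finite_PiE) auto
  moreover have "?T \<noteq> {}"
    by (simp add: PiE_eq_empty_iff)
  ultimately have "Min (?f ` ?T) \<in> ?f ` ?T"
    by (intro Min_in) auto
  then obtain \<theta> where \<theta>: "\<theta> \<in> ?T" "Min (?f ` ?T) = ?f \<theta>"
    by blast
  have "Min (?f ` ?T) \<le> I * (\<Sum>i=1..m. norm (x i) powr p) powr (1 / p)"
    using assms unfolding infratype_bound_def by blast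
  then have "?f \<theta> \<le> I * (\<Sum>i=1..m. norm (x i) powr p) powr (1 / p)"
    unfolding \<theta>(2) .
  with PiE_mem[OF \<theta>(1)] show thesis
    by (rule that)
qed

text \<open>A rewrite rule for \<open>simp only\<close>, which keeps composite denominators such as
  \<open>real (2 * n)\<close> intact.\<close>

lemma norm_scaleR_inverse_of_nat:
  fixes x :: "'a::real_normed_vector"
  shows "norm (x /\<^sub>R real n) = norm x / real n"
  by (simp add: divide_inverse_commute)

lemma sum_consecutive_pairs:
  fixes x :: "nat \<Rightarrow> 'a::ab_group_add"
  shows "(\<Sum>i=1..2*n. x i) = (\<Sum>i=1..n. x (2 * i - 1) + x (2 * i))"
  by (induction n) (auto simp: algebra_simps)

text \<open>Each of the \<open>n\<close> pair differences has norm at most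
  \<open>diameter P\<close>, so some signed sum of them has norm at most
  \<open>I * n powr (1 / p) * diameter P\<close>; division by \<open>2 * n\<close> gives the
  bound.\<close>

lemma infratype_halving:
  fixes x :: "nat \<Rightarrow> 'a::real_normed_vector"
  assumes I: "infratype_bound TYPE('a) p I" and p: "p \<ge> 1" and P: "bounded P"
    and n: "n \<ge> 1" and x: "\<And>i. i \<in> {1..2*n} \<Longrightarrow> x i \<in> P"
  obtains y where "\<And>i. i \<in> {1..n} \<Longrightarrow> y i \<in> P"
    and "norm ((\<Sum>i=1..2*n. x i) /\<^sub>R real (2 * n) - (\<Sum>i=1..n. y i) /\<^sub>R real n)
      \<le> I * diameter P / 2 * real n powr (- 1 + 1 / p)"
proof -
  define d where "d = diameter P"
  have d0: "d \<ge> 0"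
    unfolding d_def by (rule diameter_ge_0[OF P])
  have I0: "I \<ge> 0"
    using I by (simp add: infratype_bound_def)
  define z where "z = (\<lambda>i. x (2 * i) - x (2 * i - 1))"
  obtain \<theta> :: "nat \<Rightarrow> real" where \<theta>: "\<And>i. i \<in> {1..n} \<Longrightarrow> \<theta> i \<in> {-1, 1}"
    and le: "norm (\<Sum>i=1..n. \<theta> i *\<^sub>R z i) \<le> I * (\<Sum>i=1..n. norm (z i) powr p) powr (1 / p)"
    using infratype_bound_signs[OF I, of n z] by blast
  \<comment> \<open>The choice makes each pair sum equal to
    \<open>2 *\<^sub>R y i + \<theta> i *\<^sub>R z i\<close>: sign 1 keeps the first point and adds
    the difference, sign -1 keeps the second and subtracts it.\<close>
  define y where "y = (\<lambda>i. if \<theta> i = 1 then x (2 * i - 1) else x (2 * i))"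
  have yP: "y i \<in> P" if "i \<in> {1..n}" for i
    using that by (auto simp: y_def intro!: x)
  have "norm (z i) \<le> d" if "i \<in> {1..n}" for i
  proof -
    \<comment> \<open>Here \<open>i\<close> is at least 1, so the subtraction on naturals is not
      truncated.\<close>
    have "2 * i \<in> {1..2*n}" "2 * i - 1 \<in> {1..2*n}"
      using that by auto
    then show ?thesis
      unfolding z_def d_def using diameter_bounded_bound[OF P x x] by (simp only: dist_norm)
  qed
  then have "(\<Sum>i=1..n. norm (z i) powr p) \<le> (\<Sum>i=1..n. d powr p)"
    using p by (intro sum_mono powr_mono2) auto
  then have "(\<Sum>i=1..n. norm (z i) powr p) powr (1 / p) \<le> (real n * d powr p) powr (1 / p)"
    using p by (intro powr_mono2 sum_nonneg) auto
  also have "\<dots> = real n powr (1 / p) * d"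
    using p d0 by (simp add: powr_mult powr_powr)
  finally have "I * (\<Sum>i=1..n. norm (z i) powr p) powr (1 / p) \<le> I * (real n powr (1 / p) * d)"
    using I0 by (rule mult_left_mono)
  with le have le': "norm (\<Sum>i=1..n. \<theta> i *\<^sub>R z i) \<le> I * (real n powr (1 / p) * d)"
    by linarith
  have "x (2 * i - 1) + x (2 * i) = 2 *\<^sub>R y i + \<theta> i *\<^sub>R z i" if "i \<in> {1..n}" for i
    using \<theta>[OF that] by (auto simp: y_def z_def scaleR_2)
  then have "(\<Sum>i=1..2*n. x i) = (\<Sum>i=1..n. 2 *\<^sub>R y i + \<theta> i *\<^sub>R z i)"
    unfolding sum_consecutive_pairs by (rule sum.cong[OF refl])
  then have "(\<Sum>i=1..2*n. x i) = 2 *\<^sub>R (\<Sum>i=1..n. y i) + (\<Sum>i=1..n. \<theta> i *\<^sub>R z i)"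
    by (simp only: sum.distrib scaleR_sum_right)
  moreover have "inverse (real (2 * n)) * 2 = inverse (real n)"
    using n by simp
  ultimately have "(\<Sum>i=1..2*n. x i) /\<^sub>R real (2 * n) - (\<Sum>i=1..n. y i) /\<^sub>R real n
      = (\<Sum>i=1..n. \<theta> i *\<^sub>R z i) /\<^sub>R real (2 * n)"
    by (simp only: scaleR_add_right scaleR_scaleR add_diff_cancel_left')
  then have "norm ((\<Sum>i=1..2*n. x i) /\<^sub>R real (2 * n) - (\<Sum>i=1..n. y i) /\<^sub>R real n)
      = norm (\<Sum>i=1..n. \<theta> i *\<^sub>R z i) / real (2 * n)"
    by (simp only: norm_scaleR_inverse_of_nat)
  also have "\<dots> \<le> I * (real n powr (1 / p) * d) / real (2 * n)"
    using le' by (rule divide_right_mono) simp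
  also have "\<dots> = I * d / 2 * (real n powr - 1 * real n powr (1 / p))"
    using n by (simp add: powr_minus_divide)
  also have "\<dots> = I * d / 2 * real n powr (- 1 + 1 / p)"
    by (simp only: powr_add)
  finally show thesis
    using that yP unfolding d_def by blast
qed

text \<open>Passing from \<open>2 * 2^j * k\<close> to \<open>2^j * k\<close> points costs the price
  of the last halving times the \<open>j\<close>-th power of \<open>2 powr (- 1 + 1 / p)\<close>.
  The induction peels off the first halving, so \<open>x\<close> has to vary.\<close>

lemma infratype_iterated_halving:
  fixes x :: "nat \<Rightarrow> 'a::real_normed_vector"
  assumes I: "infratype_bound TYPE('a) p I" and p: "p \<ge> 1" and P: "bounded P"
    and k: "k \<ge> 1" and x: "\<And>i. i \<in> {1..2^r*k} \<Longrightarrow> x i \<in> P"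
  shows "\<exists>y. (\<forall>i\<in>{1..k}. y i \<in> P) \<and>
    norm ((\<Sum>i=1..2^r*k. x i) /\<^sub>R real (2^r*k) - (\<Sum>i=1..k. y i) /\<^sub>R real k)
      \<le> I * diameter P / 2 * real k powr (- 1 + 1 / p) * (\<Sum>j<r. (2 powr (- 1 + 1 / p)) ^ j)"
  using x
proof (induction r arbitrary: x)
  case 0
  then show ?case
    by (intro exI[of _ x]) auto
next
  case (Suc r)
  let ?c = "I * diameter P / 2 * real k powr (- 1 + 1 / p)"
  let ?q = "2 powr (- 1 + 1 / p)"
  let ?n = "2^r*k"
  have "?n \<ge> 1"
    using k by simp
  then obtain w where w: "\<And>i. i \<in> {1..?n} \<Longrightarrow> w i \<in> P"
    and xw: "norm ((\<Sum>i=1..2*?n. x i) /\<^sub>R real (2 * ?n) - (\<Sum>i=1..?n. w i) /\<^sub>R real ?n)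
      \<le> I * diameter P / 2 * real ?n powr (- 1 + 1 / p)"
    using infratype_halving[OF I p P, of ?n x] Suc.prems unfolding power_Suc mult.assoc by blast
  obtain y where y: "\<forall>i\<in>{1..k}. y i \<in> P"
    and wy: "norm ((\<Sum>i=1..?n. w i) /\<^sub>R real ?n - (\<Sum>i=1..k. y i) /\<^sub>R real k)
      \<le> ?c * (\<Sum>j<r. ?q ^ j)"
    using Suc.IH[of w] w by blast
  have "real ?n powr (- 1 + 1 / p) = ?q ^ r * real k powr (- 1 + 1 / p)"
    by (simp add: powr_mult powr_powr mult.commute flip: powr_realpow)
  with xw have xw': "norm ((\<Sum>i=1..2*?n. x i) /\<^sub>R real (2 * ?n) - (\<Sum>i=1..?n. w i) /\<^sub>R real ?n)
      \<le> ?c * ?q ^ r"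
    by (simp add: mult_ac)
  have "norm ((\<Sum>i=1..2*?n. x i) /\<^sub>R real (2 * ?n) - (\<Sum>i=1..k. y i) /\<^sub>R real k)
      \<le> ?c * ?q ^ r + ?c * (\<Sum>j<r. ?q ^ j)"
    by (rule norm_diff_triangle_le[OF xw' wy])
  then have "norm ((\<Sum>i=1..2*?n. x i) /\<^sub>R real (2 * ?n) - (\<Sum>i=1..k. y i) /\<^sub>R real k)
      \<le> ?c * (\<Sum>j<Suc r. ?q ^ j)"
    by (simp add: distrib_left add.commute)
  moreover have "2 ^ Suc r * k = 2 * ?n"
    by simp
  ultimately show ?case
    using y by metis
qed

text \<open>What matters is that \<open>C\<close> does not depend on \<open>N\<close>: after
  division by \<open>N\<close>, averages of \<open>N\<close> points of \<open>P\<close>, repetitions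
  allowed, approach \<open>a\<close> with error at most \<open>C / N\<close>.\<close>

lemma convex_hull_approx_sum:
  fixes P :: "'a::real_normed_vector set"
  assumes "a \<in> convex hull P"
  obtains C where "\<And>N::nat. \<exists>x. (\<forall>i\<in>{1..N}. x i \<in> P) \<and> norm (real N *\<^sub>R a - (\<Sum>i=1..N. x i)) \<le> C"
proof -
  define G where "G = {a. \<exists>C. \<forall>N::nat. \<exists>x. (\<forall>i\<in>{1..N}. x i \<in> P) \<and>
    norm (real N *\<^sub>R a - (\<Sum>i=1..N. x i)) \<le> C}"
  have "P \<subseteq> G"
  proof
    fix a assume "a \<in> P"
    then show "a \<in> G"
      unfolding G_def by (auto intro!: exI[of _ 0] exI[of _ "\<lambda>_. a"] simp: sum_constant_scaleR)
  qed
  moreover have "convex G"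
  proof (rule convexI)
    fix a b :: 'a and u v :: real
    assume "a \<in> G" "b \<in> G" and uv: "0 \<le> u" "0 \<le> v" "u + v = 1"
    then obtain C D where
      C: "\<And>N::nat. \<exists>x. (\<forall>i\<in>{1..N}. x i \<in> P) \<and> norm (real N *\<^sub>R a - (\<Sum>i=1..N. x i)) \<le> C" and
      D: "\<And>N::nat. \<exists>x. (\<forall>i\<in>{1..N}. x i \<in> P) \<and> norm (real N *\<^sub>R b - (\<Sum>i=1..N. x i)) \<le> D"
      unfolding G_def by blast
    have "\<exists>z. (\<forall>i\<in>{1..N}. z i \<in> P) \<and>
        norm (real N *\<^sub>R (u *\<^sub>R a + v *\<^sub>R b) - (\<Sum>i=1..N. z i)) \<le> C + D + norm a + norm b" for N :: nat
    proof -
      \<comment> \<open>Of the \<open>N\<close> points, about \<open>N * u\<close> are devoted to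
        \<open>a\<close> and the others to \<open>b\<close>. Rounding shifts the two weights by at
        most 1, which costs at most \<open>norm a + norm b\<close> whatever \<open>N\<close>
        is.\<close>
      define m where "m = nat \<lfloor>real N * u\<rfloor>"
      have Nu: "0 \<le> real N * u" "real N * u \<le> real N"
        using uv by (auto intro: mult_left_le)
      have m: "real m \<le> real N * u" "real N * u \<le> real m + 1"
        using Nu unfolding m_def by linarith+
      define n where "n = N - m"
      have N: "N = m + n"
        using m Nu by (simp add: n_def)
      obtain x where x: "\<forall>i\<in>{1..m}. x i \<in> P" "norm (real m *\<^sub>R a - (\<Sum>i=1..m. x i)) \<le> C"
        using C by blast
      obtain y where y: "\<forall>i\<in>{1..n}. y i \<in> P" "norm (real n *\<^sub>R b - (\<Sum>i=1..n. y i)) \<le> D"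
        using D by blast
      define z where "z = (\<lambda>i. if i \<le> m then x i else y (i - m))"
      have zP: "\<forall>i\<in>{1..N}. z i \<in> P"
      proof
        fix i assume "i \<in> {1..N}"
        then have "i \<in> {1..m} \<or> \<not> i \<le> m \<and> i - m \<in> {1..n}"
          unfolding N by auto
        then show "z i \<in> P"
          using x(1) y(1) by (auto simp: z_def)
      qed
      have "(\<Sum>i=1..N. z i) = (\<Sum>i=1..m. z i) + (\<Sum>i=m+1..m+n. z i)"
        unfolding N by (rule sum.ub_add_nat) simp
      also have "(\<Sum>i=m+1..m+n. z i) = (\<Sum>i=1..n. z (i + m))"
        using sum.shift_bounds_cl_nat_ivl[of z 1 m n] by (simp add: add.commute)
      also have "\<dots> = (\<Sum>i=1..n. y i)"
        by (intro sum.cong) (auto simp: z_def)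
      also have "(\<Sum>i=1..m. z i) = (\<Sum>i=1..m. x i)"
        by (intro sum.cong) (auto simp: z_def)
      finally have z: "(\<Sum>i=1..N. z i) = (\<Sum>i=1..m. x i) + (\<Sum>i=1..n. y i)" .
      define t where "t = real N * u - real m"
      have t: "0 \<le> t" "t \<le> 1"
        using m by (auto simp: t_def)
      have Nu': "real N * u = real m + t"
        by (simp add: t_def)
      have "v = 1 - u"
        using uv by simp
      \<comment> \<open>As \<open>u + v = 1\<close>, the rounding error for \<open>b\<close> is that
        for \<open>a\<close> with the opposite sign.\<close>
      then have Nv: "real N * v = real n - t"
        using Nu' by (simp add: right_diff_distrib N)
      \<comment> \<open>The last term is an added negative because \<open>norm_triangle_mono\<close>
        splits sums only.\<close>
      have "real N *\<^sub>R (u *\<^sub>R a + v *\<^sub>R b) - (\<Sum>i=1..N. z i)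
          = (real m *\<^sub>R a - (\<Sum>i=1..m. x i)) + (real n *\<^sub>R b - (\<Sum>i=1..n. y i))
            + t *\<^sub>R a + (- (t *\<^sub>R b))"
        unfolding z scaleR_add_right scaleR_scaleR Nv Nu' by (simp add: algebra_simps)
      also have "norm \<dots> \<le> C + D + norm (t *\<^sub>R a) + norm (t *\<^sub>R b)"
        by (intro norm_triangle_mono x y) simp_all
      also have "\<dots> \<le> C + D + norm a + norm b"
        using t by (intro add_mono order_refl) (auto intro: mult_left_le_one_le)
      finally show ?thesis
        using zP by blast
    qed
    then show "u *\<^sub>R a + v *\<^sub>R b \<in> G"
      unfolding G_def by blast
  qed
  ultimately have "convex hull P \<subseteq> G"
    by (rule hull_minimal)
  with assms that show thesis
    unfolding G_def by blast
qed

lemma average_in_conv_k: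
  assumes "k \<ge> 1" "\<forall>i\<in>{1..k}. y i \<in> P"
  shows "(\<Sum>i=1..k. y i) /\<^sub>R real k \<in> conv_k k P"
  unfolding conv_k_def using assms
  by (intro CollectI exI[of _ k] exI[of _ "\<lambda>_. inverse (real k)"] exI[of _ y])
     (auto simp: scaleR_sum_right)

text \<open>The starting average only approximates \<open>a\<close>, hence the slack
  \<open>e\<close>. Since \<open>p > 1\<close>, the geometric ratio is below 1 and the total cost of
  the halvings is bounded uniformly in their number.\<close>

lemma infdist_conv_k_le:
  fixes P :: "'a::real_normed_vector set"
  assumes I: "infratype_bound TYPE('a) p I" and p: "p > 1" and P: "bounded P"
    and k: "k \<ge> 1" and a: "a \<in> convex hull P"
  shows "infdist a (conv_k k P)
    \<le> I * diameter P / (2 * (1 - 2 powr (- 1 + 1 / p))) * real k powr (- 1 + 1 / p)"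
proof (rule field_le_epsilon)
  fix e :: real assume e: "e > 0"
  let ?c = "I * diameter P / 2 * real k powr (- 1 + 1 / p)"
  let ?q = "2 powr (- 1 + 1 / p)"
  have q: "0 < ?q" "?q < 1"
    using p by (auto intro: powr_less_one)
  have c: "?c \<ge> 0"
    using I diameter_ge_0[OF P] by (simp add: infratype_bound_def)
  obtain C where C: "\<And>N::nat. \<exists>x. (\<forall>i\<in>{1..N}. x i \<in> P) \<and>
      norm (real N *\<^sub>R a - (\<Sum>i=1..N. x i)) \<le> C"
    using convex_hull_approx_sum[OF a] by blast
  \<comment> \<open>With this \<open>r\<close>, the initial error \<open>C / (2^r * k)\<close> is at
    most \<open>e\<close>.\<close>
  obtain r :: nat where r: "C / e < 2 ^ r"
    using real_arch_pow[of 2 "C / e"] by auto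
  let ?N = "2^r*k"
  have "C < e * 2 ^ r"
    using r e by (simp add: field_simps)
  also have "\<dots> \<le> e * real ?N"
    using e k by simp
  finally have CN: "C / real ?N \<le> e"
    using k by (simp add: field_simps)
  obtain x where x: "\<forall>i\<in>{1..?N}. x i \<in> P" "norm (real ?N *\<^sub>R a - (\<Sum>i=1..?N. x i)) \<le> C"
    using C by blast
  have "a - (\<Sum>i=1..?N. x i) /\<^sub>R real ?N = (real ?N *\<^sub>R a - (\<Sum>i=1..?N. x i)) /\<^sub>R real ?N"
    using k by (simp add: scaleR_diff_right del: of_nat_mult)
  then have "norm (a - (\<Sum>i=1..?N. x i) /\<^sub>R real ?N)
      = norm (real ?N *\<^sub>R a - (\<Sum>i=1..?N. x i)) / real ?N"
    by (simp only: norm_scaleR_inverse_of_nat)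
  also have "\<dots> \<le> C / real ?N"
    using x(2) by (rule divide_right_mono) simp
  finally have ax: "norm (a - (\<Sum>i=1..?N. x i) /\<^sub>R real ?N) \<le> e"
    using CN by linarith
  obtain y where y: "\<forall>i\<in>{1..k}. y i \<in> P"
    and xy: "norm ((\<Sum>i=1..?N. x i) /\<^sub>R real ?N - (\<Sum>i=1..k. y i) /\<^sub>R real k)
      \<le> ?c * (\<Sum>j<r. ?q ^ j)"
    using infratype_iterated_halving[OF I _ P k, of r x] p x(1) by auto
  \<comment> \<open>The full series replaces the partial sum because \<open>r\<close> depends on
    \<open>e\<close>, while the final bound must not.\<close>
  have "(\<Sum>j<r. ?q ^ j) \<le> 1 / (1 - ?q)"
    using sum_le_suminf[of "\<lambda>j. ?q ^ j" "{..<r}"] q by (simp add: suminf_geometric)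
  then have geo: "?c * (\<Sum>j<r. ?q ^ j) \<le> ?c * (1 / (1 - ?q))"
    using c by (rule mult_left_mono)
  have "infdist a (conv_k k P) \<le> dist a ((\<Sum>i=1..k. y i) /\<^sub>R real k)"
    using average_in_conv_k[OF k y] by (rule infdist_le)
  also have "\<dots> \<le> dist a ((\<Sum>i=1..?N. x i) /\<^sub>R real ?N)
      + dist ((\<Sum>i=1..?N. x i) /\<^sub>R real ?N) ((\<Sum>i=1..k. y i) /\<^sub>R real k)"
    by (rule dist_triangle)
  also have "\<dots> \<le> e + ?c * (1 / (1 - ?q))"
    unfolding dist_norm using ax xy geo by linarith
  also have "?c * (1 / (1 - ?q))
      = I * diameter P / (2 * (1 - ?q)) * real k powr (- 1 + 1 / p)"
    by simp
  finally show "infdist a (conv_k k P)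
      \<le> I * diameter P / (2 * (1 - ?q)) * real k powr (- 1 + 1 / p) + e"
    by linarith
qed

theorem lemma9p2:
  fixes p :: real and k :: nat
  assumes "has_infratype TYPE('a::banach) p" and "p > 1" and "k \<ge> 1"
  shows "Car TYPE('a) k \<le>
    ennreal (infratype_const TYPE('a) p / (2 * (1 - 2 powr (- 1 + 1 / p))) * real k powr (- 1 + 1 / p))"
  unfolding Car_def
proof (intro SUP_least ennreal_leI)
  fix P :: "'a set" and a
  assume "P \<in> {P. bounded P \<and> 0 < diameter P}" and a: "a \<in> convex hull P"
  then have P: "bounded P" "0 < diameter P"
    by auto
  \<comment> \<open>The least constant is itself an infratype bound, and \<open>diameter P\<close>
    is positive, so the previous estimate can be divided by it.\<close>
  show "infdist a (conv_k k P) / diameter P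
    \<le> infratype_const TYPE('a) p / (2 * (1 - 2 powr (- 1 + 1 / p))) * real k powr (- 1 + 1 / p)"
    using infdist_conv_k_le[OF infratype_const(1)[OF assms(1)] assms(2) P(1) assms(3) a] P(2)
    by (simp add: pos_divide_le_eq mult_ac)
qed

end
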